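(* Let $f\in\mathrm{H}^+(\mathbb{R})$. There is an involution $\tau\in\mathrm{H}^-(\mathbb{R})$ such that $\tau f\tau=f$ if and only if $f$ has a square root in $\mathrm{H}^-(\mathbb{R})$, that is, if and only if there is $g\in\mathrm{H}^-(\mathbb{R})$ with $g^2=g\circ g=f$.
   Context: $\mathrm{H}^+(\mathbb{R})$ is the group of orientation preserving (strictly increasing) homeomorphisms of $\mathbb{R}$, and $\mathrm{H}^-(\mathbb{R})$ is the set of orientation reversing (strictly decreasing) homeomorphisms of $\mathbb{R}$. Products denote composition. An involution is an element whose square is the identity. *)

theory Defs
  imports "HOL-Analysis.Analysis"
begin

definition H_plus :: "(real \<Rightarrow> real) set" where
  "H_plus = {f. homeomorphic_map euclideanreal euclideanreal f \<and> strict_mono f}"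

definition H_minus :: "(real \<Rightarrow> real) set" where
  "H_minus = {f. homeomorphic_map euclideanreal euclideanreal f \<and> monotone (<) (>) f}"

definition involution :: "('a \<Rightarrow> 'a) \<Rightarrow> bool" where
  "involution f \<longleftrightarrow> f \<circ> f = id"

end

theory Submission
  imports Defs
begin

text \<open>
  An involution \<open>\<tau>\<close> commuting with \<open>f\<close> and a decreasing square root \<open>g\<close> of \<open>f\<close> both have a unique
  fixed point \<open>p\<close>, which is also fixed by \<open>f\<close>. Given \<open>g\<close>, let \<open>\<tau>\<close> be \<open>g\<close> to the right of \<open>p\<close> and the
  inverse of \<open>g\<close> to the left. Given \<open>\<tau>\<close>, take an increasing square root \<open>h\<close> of \<open>f\<close> and let \<open>g\<close> be
  \<open>\<tau> \<circ> h\<close> to the right of \<open>p\<close> and \<open>h \<circ> \<tau>\<close> to the left.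

  The increasing square root is found without choosing fundamental domains. If \<open>f x \<ge> x\<close> everywhere,
  then \<open>\<Phi> x y = (\<Sum>n\<in>\<int>. arctan (f\<^sup>n y) - arctan (f\<^sup>n x))\<close> converges for \<open>x \<le> y \<le> f x\<close>, is additive,
  invariant under \<open>f\<close>, and strictly increasing and continuous in \<open>y\<close>; the point \<open>h x\<close> is the one that
  halves \<open>[x, f x]\<close> with respect to \<open>\<Phi>\<close>. The general \<open>f\<close> is a product of one map lying above and one
  map lying below the identity.
\<close>

section \<open>Monotone surjections of the line\<close>

lemma continuous_on_mono_surj:
  fixes f :: "real \<Rightarrow> real"
  assumes "mono f" "surj f"
  shows "continuous_on A f"
proof -
  have "continuous_on UNIV f"
    using assms by (intro continuous_onI_mono) (auto simp: monoD)
  then show ?thesis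
    using continuous_on_subset by blast
qed

lemma strict_mono_inv_surj:
  fixes f :: "'a::linorder \<Rightarrow> 'b::linorder"
  assumes "strict_mono f" "surj f"
  shows "strict_mono (inv f)"
proof (rule strict_monoI)
  fix x y :: 'b assume "x < y"
  then have "f (inv f x) < f (inv f y)"
    using assms(2) by (simp add: surj_f_inv_f)
  then show "inv f x < inv f y"
    using assms(1) by (simp add: strict_mono_less)
qed

lemma H_plus_iff: "f \<in> H_plus \<longleftrightarrow> strict_mono f \<and> surj f"
proof
  assume "f \<in> H_plus"
  then show "strict_mono f \<and> surj f"
    using homeomorphic_imp_surjective_map by (fastforce simp: H_plus_def)
next
  assume f: "strict_mono f \<and> surj f"
  then have "inj f" "mono f" "mono (inv f)" "surj (inv f)"
    by (auto simp: strict_mono_imp_inj_on strict_mono_mono strict_mono_inv_surj inj_imp_surj_inv)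
  then have "homeomorphic_maps euclideanreal euclideanreal f (inv f)"
    using f by (auto simp: homeomorphic_maps_def continuous_on_mono_surj surj_f_inv_f)
  then show "f \<in> H_plus"
    using f homeomorphic_map_maps by (auto simp: H_plus_def)
qed

text \<open>Negation is a homeomorphism that reverses the order, so facts about decreasing
  homeomorphisms reduce to facts about increasing ones.\<close>

lemma uminus_comp_H_plus_iff: "uminus \<circ> g \<in> H_plus \<longleftrightarrow> g \<in> H_minus"
proof -
  have u: "homeomorphic_map euclideanreal euclideanreal uminus"
    by (auto simp: homeomorphic_map_maps homeomorphic_maps_def intro!: exI[of _ uminus] continuous_intros)
  have "homeomorphic_map euclideanreal euclideanreal (uminus \<circ> g)"
    if "homeomorphic_map euclideanreal euclideanreal g" for g :: "real \<Rightarrow> real"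
    using homeomorphic_map_compose[OF that u] .
  from this[of g] this[of "uminus \<circ> g"] show ?thesis
    by (auto simp: H_plus_def H_minus_def strict_mono_def monotone_def comp_def)
qed

lemma H_minus_iff: "g \<in> H_minus \<longleftrightarrow> monotone (<) (>) g \<and> surj g"
proof -
  have "surj (uminus \<circ> g) \<longleftrightarrow> surj g"
    unfolding surj_def comp_def by (metis minus_equation_iff)
  moreover have "strict_mono (uminus \<circ> g) \<longleftrightarrow> monotone (<) (>) g"
    by (auto simp: strict_mono_def monotone_def)
  ultimately show ?thesis
    unfolding uminus_comp_H_plus_iff[symmetric] H_plus_iff by blast
qed

section \<open>Order and fixed points of decreasing homeomorphisms\<close>

lemma H_minus_less_iff:
  assumes "g \<in> H_minus"
  shows "g x < g y \<longleftrightarrow> y < x"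
  using assms unfolding H_minus_iff monotone_def by (metis less_asym linorder_neqE)

lemma H_minus_inject:
  assumes "g \<in> H_minus"
  shows "g x = g y \<longleftrightarrow> x = y"
  using H_minus_less_iff[OF assms] by (metis less_irrefl linorder_neqE)

lemma inv_H_minus:
  assumes "g \<in> H_minus"
  shows "inv g \<in> H_minus"
proof -
  have s: "surj g"
    using assms by (simp add: H_minus_iff)
  have "inj g"
    using H_minus_inject[OF assms] by (simp add: inj_def)
  moreover have "inv g y < inv g x" if "x < y" for x y
    using H_minus_less_iff[OF assms, of "inv g x" "inv g y"] that s by (simp add: surj_f_inv_f)
  ultimately show ?thesis
    by (auto simp: H_minus_iff monotone_def inj_imp_surj_inv)
qed

lemma H_minus_fixpoint:
  assumes "g \<in> H_minus"
  obtains p where "g p = p"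
proof -
  have "mono (uminus \<circ> g)" "surj (uminus \<circ> g)"
    using assms uminus_comp_H_plus_iff[of g] by (auto simp: H_plus_iff strict_mono_mono)
  from continuous_on_mono_surj[OF this]
  have "continuous_on A (\<lambda>x. x + (uminus \<circ> g) x)" for A
    by (intro continuous_on_add continuous_on_id)
  then have c: "continuous_on A (\<lambda>x. x - g x)" for A
    by simp
  \<comment> \<open>Applying \<open>g\<close> to the inequality between \<open>0\<close> and
    \<open>g 0\<close> reverses it, so \<open>x - g x\<close> passes from nonpositive to nonnegative
    between these points.\<close>
  let ?a = "min 0 (g 0)" and ?b = "max 0 (g 0)"
  have "g ?a \<ge> ?a" "g ?b \<le> ?b"
    using H_minus_less_iff[OF assms, of "g 0" 0] H_minus_less_iff[OF assms, of 0 "g 0"]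
    by (auto simp: min_def max_def not_le le_less)
  then have "\<exists>x\<ge>?a. x \<le> ?b \<and> x - g x = 0"
    using c by (intro IVT') auto
  then obtain x where "x - g x = 0"
    by blast
  then show ?thesis
    by (intro that[of x]) simp
qed

lemma H_minus_fixpoint_unique:
  assumes "g \<in> H_minus" "g p = p" "g q = q"
  shows "p = q"
  using H_minus_less_iff[OF assms(1), of p q] assms(2,3) by (cases p q rule: linorder_cases) auto

text \<open>Both pieces swap the sides of \<open>p\<close>, which orders values across the seam.
  Surjectivity is a hypothesis because each use reads it off from the square of the glued
  map.\<close>

lemma glue_H_minus:
  assumes a: "monotone (<) (>) a" "a p = p" and b: "monotone (<) (>) b" "b p = p"
    and s: "surj (\<lambda>x::real. if p \<le> x then a x else b x)"
  shows "(\<lambda>x::real. if p \<le> x then a x else b x) \<in> H_minus"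
proof -
  have "a y < b x" if "x < p" "p \<le> y" for x y
    using monotoneD[OF b(1), of x p] monotoneD[OF a(1), of p y] that a(2) b(2)
    by (cases "y = p") auto
  then have "monotone (<) (>) (\<lambda>x. if p \<le> x then a x else b x)"
    using a(1) b(1) by (auto simp: monotone_def)
  with s show ?thesis
    by (simp add: H_minus_iff)
qed

section \<open>Increasing square roots\<close>

text \<open>One half of the two-sided sum; the other half uses the inverse map. Since
  \<open>arctan\<close> is bounded, even an unbounded orbit of a monotone map has finite total
  length.\<close>

definition orbit_sum :: "(real \<Rightarrow> real) \<Rightarrow> real \<Rightarrow> real \<Rightarrow> real" where
  "orbit_sum k p q = (\<Sum>n. arctan ((k ^^ n) q) - arctan ((k ^^ n) p))"

lemma strict_mono_funpow:
  fixes k :: "'a::order \<Rightarrow> 'a"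
  assumes "strict_mono k"
  shows "strict_mono (k ^^ n)"
  by (induction n) (use assms in \<open>auto simp: strict_mono_def\<close>)

text \<open>Orbits of a monotone map are monotone sequences, and \<open>arctan\<close> makes them
  bounded, so the steps telescope to a finite total.\<close>

lemma summable_orbit_step:
  fixes k :: "real \<Rightarrow> real"
  assumes "mono k"
  shows "summable (\<lambda>n. \<bar>arctan ((k ^^ Suc n) u) - arctan ((k ^^ n) u)\<bar>)"
proof -
  let ?s = "\<lambda>n. arctan ((k ^^ n) u)"
  have shift: "(k ^^ Suc n) u = (k ^^ n) (k u)" for n
    by (simp add: funpow_swap1)
  have Bs: "Bseq ?s"
  proof (rule BseqI')
    show "norm (?s n) \<le> pi / 2" for n
      using arctan_lbound[of "(k ^^ n) u"] arctan_ubound[of "(k ^^ n) u"] by (simp add: abs_le_iff)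
  qed
  have c: "convergent ?s" if "monoseq ?s"
    using Bs that by (rule Bseq_monoseq_convergent)
  consider "u \<le> k u" | "k u \<le> u"
    by linarith
  then show ?thesis
  proof cases
    case 1
    then have le: "?s n \<le> ?s (Suc n)" for n
      unfolding shift arctan_le_iff using monoD[OF mono_pow[OF assms]] by blast
    then obtain l where "?s \<longlonglongrightarrow> l"
      using c[OF mono_SucI1] by (auto simp: convergent_def)
    from telescope_summable[OF this] show ?thesis
      using le by (simp add: abs_of_nonneg)
  next
    case 2
    then have le: "?s (Suc n) \<le> ?s n" for n
      unfolding shift arctan_le_iff using monoD[OF mono_pow[OF assms]] by blast
    then obtain l where "?s \<longlonglongrightarrow> l"
      using c[OF mono_SucI2] by (auto simp: convergent_def)
    from telescope_summable'[OF this] show ?thesis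
      using le by (simp add: abs_of_nonpos)
  qed
qed

text \<open>\<open>k ^^ n\<close> sends the interval between \<open>u\<close> and \<open>k u\<close>
  into the one between consecutive orbit points. The bound is uniform in \<open>p\<close> and
  \<open>q\<close>, hence gives both summability and, by the Weierstrass test, continuity. With
  \<open>min\<close> and \<open>max\<close>, \<open>k\<close> may be \<open>f\<close> or its
  inverse.\<close>

lemma orbit_term_bound:
  fixes k :: "real \<Rightarrow> real"
  assumes "mono k" "p \<in> {min u (k u)..max u (k u)}" "q \<in> {min u (k u)..max u (k u)}"
  shows "\<bar>arctan ((k ^^ n) q) - arctan ((k ^^ n) p)\<bar> \<le> \<bar>arctan ((k ^^ Suc n) u) - arctan ((k ^^ n) u)\<bar>"
proof -
  have m: "mono (\<lambda>x. arctan ((k ^^ n) x))"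
    using mono_pow[OF assms(1)] by (auto simp: mono_def arctan_le_iff)
  have "(k ^^ Suc n) u = (k ^^ n) (k u)"
    by (simp add: funpow_swap1)
  then show ?thesis
    using assms(2,3) monoD[OF m, of u p] monoD[OF m, of u q] monoD[OF m, of p "k u"]
      monoD[OF m, of q "k u"] monoD[OF m, of "k u" p] monoD[OF m, of "k u" q]
      monoD[OF m, of p u] monoD[OF m, of q u]
    by (cases "u \<le> k u") (auto simp: min_def max_def abs_if)
qed

lemma summable_orbit_sum:
  fixes k :: "real \<Rightarrow> real"
  assumes "mono k" "p \<in> {min u (k u)..max u (k u)}" "q \<in> {min u (k u)..max u (k u)}"
  shows "summable (\<lambda>n. arctan ((k ^^ n) q) - arctan ((k ^^ n) p))"
  by (rule summable_comparison_test'[OF summable_orbit_step[OF assms(1), of u]])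
    (use orbit_term_bound[OF assms] in simp)

lemma continuous_on_orbit_sum:
  fixes k :: "real \<Rightarrow> real"
  assumes "mono k" "surj k" "p \<in> {min u (k u)..max u (k u)}"
  shows "continuous_on {min u (k u)..max u (k u)} (orbit_sum k p)"
proof -
  have "continuous_on {min u (k u)..max u (k u)} (k ^^ n)" for n
    using continuous_on_mono_surj mono_pow[OF assms(1)] surj_fn[OF assms(2)] by blast
  then have "continuous_on {min u (k u)..max u (k u)}
      (\<lambda>q. \<Sum>i<n. arctan ((k ^^ i) q) - arctan ((k ^^ i) p))" for n
    by (intro continuous_intros) auto
  moreover have "uniform_limit {min u (k u)..max u (k u)}
      (\<lambda>n q. \<Sum>i<n. arctan ((k ^^ i) q) - arctan ((k ^^ i) p))
      (\<lambda>q. \<Sum>i. arctan ((k ^^ i) q) - arctan ((k ^^ i) p)) sequentially"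
    by (rule Weierstrass_m_test[OF _ summable_orbit_step[OF assms(1), of u]])
      (use orbit_term_bound[OF assms(1,3)] in simp)
  ultimately show ?thesis
    unfolding orbit_sum_def by (intro uniform_limit_theorem) (auto simp: always_eventually)
qed

lemma orbit_sum_unfold:
  assumes "summable (\<lambda>n. arctan ((k ^^ n) q) - arctan ((k ^^ n) p))"
  shows "orbit_sum k p q = arctan q - arctan p + orbit_sum k (k p) (k q)"
  unfolding orbit_sum_def using suminf_split_head[OF assms] by (simp add: funpow_swap1)

lemma orbit_sum_add:
  assumes "summable (\<lambda>n. arctan ((k ^^ n) q) - arctan ((k ^^ n) p))"
    and "summable (\<lambda>n. arctan ((k ^^ n) r) - arctan ((k ^^ n) q))"
  shows "orbit_sum k p r = orbit_sum k p q + orbit_sum k q r"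
  unfolding orbit_sum_def using suminf_add[OF assms] by simp

lemma orbit_sum_pos:
  assumes "summable (\<lambda>n. arctan ((k ^^ n) q) - arctan ((k ^^ n) p))" "strict_mono k" "p < q"
  shows "0 < orbit_sum k p q"
  unfolding orbit_sum_def
  by (rule suminf_pos[OF assms(1)])
    (use strict_mono_funpow[OF assms(2)] assms(3) in \<open>simp add: strict_mono_less arctan_less_iff\<close>)

lemma strict_mono_sqrt_above_id:
  fixes f :: "real \<Rightarrow> real"
  assumes f: "strict_mono f" "surj f" and above: "\<And>x. x \<le> f x"
  shows "\<exists>h. strict_mono h \<and> h \<circ> h = f"
proof -
  define g where "g = inv f"
  have gf: "g (f x) = x" for x
    unfolding g_def using f(1) by (simp add: strict_mono_imp_inj_on)
  have g: "strict_mono g" "surj g"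
    unfolding g_def using f
    by (auto simp: strict_mono_inv_surj strict_mono_imp_inj_on inj_imp_surj_inv)
  have mono: "mono f" "mono g"
    using f g by (auto simp: strict_mono_mono)
  have g_le: "g x \<le> x" for x
    using above monoD[OF mono(2), of x "f x"] gf by simp

  \<comment> \<open>The backward sum starts at \<open>g x\<close>, so that the term for exponent 0
    is counted only once.\<close>
  define \<Phi> where "\<Phi> x y = orbit_sum f x y + orbit_sum g (g x) (g y)" for x y
  have sf: "summable (\<lambda>n. arctan ((f ^^ n) y) - arctan ((f ^^ n) x))"
    if "x \<le> y" "y \<le> f x" for x y
    by (rule summable_orbit_sum[where u = x, OF mono(1)]) (use that above[of x] in auto)
  have sg: "summable (\<lambda>n. arctan ((g ^^ n) (g y)) - arctan ((g ^^ n) (g x)))"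
    if "x \<le> y" "y \<le> f x" for x y
    by (rule summable_orbit_sum[where u = x, OF mono(2)])
      (use that g_le[of x] monoD[OF mono(2), of y "f x"] monoD[OF mono(2), of x y] gf in auto)
  have add: "\<Phi> x z = \<Phi> x y + \<Phi> y z" if "x \<le> y" "y \<le> f x" "y \<le> z" "z \<le> f y" for x y z
    unfolding \<Phi>_def
    using orbit_sum_add[OF sf[OF that(1,2)] sf[OF that(3,4)]]
      orbit_sum_add[OF sg[OF that(1,2)] sg[OF that(3,4)]] by simp
  have pos: "0 < \<Phi> x y" if "x < y" "y \<le> f x" for x y
    unfolding \<Phi>_def
    using orbit_sum_pos[OF sf f(1), of x y] orbit_sum_pos[OF sg g(1), of x y] that g(1)
    by (simp add: strict_mono_less)
  have refl: "\<Phi> x x = 0" for x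
    by (simp add: \<Phi>_def orbit_sum_def)
  \<comment> \<open>Applying \<open>f\<close> to both points moves the term
    \<open>arctan y - arctan x\<close> from the forward sum to the backward one.\<close>
  have invariant: "\<Phi> (f x) (f y) = \<Phi> x y" if "x \<le> y" "y \<le> f x" for x y
  proof -
    have "summable (\<lambda>n. arctan ((g ^^ n) y) - arctan ((g ^^ n) x))"
      using sg[of "f x" "f y"] that mono(1) by (simp add: gf monoD)
    from orbit_sum_unfold[OF this] orbit_sum_unfold[OF sf[OF that]] show ?thesis
      by (simp add: \<Phi>_def gf)
  qed
  have cont: "continuous_on {x..f x} (\<Phi> x)" for x
  proof -
    have "continuous_on {x..f x} (orbit_sum f x)"
      using continuous_on_orbit_sum[OF mono(1) f(2), of x x] above[of x] by (simp add: min_absorb1 max_absorb2)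
    moreover have "continuous_on {g x..x} (orbit_sum g (g x))"
      using continuous_on_orbit_sum[OF mono(2) g(2), of "g x" x] g_le[of x]
      by (simp add: min_absorb2 max_absorb1)
    then have "continuous_on {x..f x} (\<lambda>y. orbit_sum g (g x) (g y))"
      by (rule continuous_on_compose2[OF _ continuous_on_mono_surj[OF mono(2) g(2)]])
        (use monoD[OF mono(2)] gf in force)
    ultimately show ?thesis
      unfolding \<Phi>_def by (intro continuous_intros)
  qed

  have "\<exists>y\<ge>x. y \<le> f x \<and> \<Phi> x y = \<Phi> x (f x) / 2" for x
    using pos[of x "f x"] above[of x] refl[of x] cont
    by (intro IVT') (auto simp: le_less)
  then obtain h where h: "x \<le> h x" "h x \<le> f x" "\<Phi> x (h x) = \<Phi> x (f x) / 2" for x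
    by metis
  \<comment> \<open>Cut \<open>[y, f y]\<close> at \<open>f x\<close> and move the piece
    \<open>[f x, f y]\<close> back to \<open>[x, y]\<close>: the result is
    \<open>[x, f x]\<close>.\<close>
  have period: "\<Phi> y (f y) = \<Phi> x (f x)" if "x \<le> y" "y \<le> f x" for x y
    using add[of x y "f x"] add[of y "f x" "f y"] invariant[of x y] that monoD[OF mono(1), of x y]
      monoD[OF mono(1), of y "f x"]
    by simp
  have inj: "y = z" if "x \<le> y" "y \<le> f x" "x \<le> z" "z \<le> f x" "\<Phi> x y = \<Phi> x z" for x y z
  proof (rule ccontr)
    have *: "\<Phi> x a < \<Phi> x b" if "x \<le> a" "a < b" "b \<le> f x" for a b
      using add[of x a b] pos[of a b] that monoD[OF mono(1), of x a] by simp
    assume "y \<noteq> z"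
    then show False
      using *[of y z] *[of z y] that by (cases y z rule: linorder_cases) auto
  qed
  have "h x < h y" if "x < y" for x y
  proof (cases "f x \<le> y")
    case True
    show ?thesis
    proof (cases "h x = f x")
      case True
      then have "x = f x"
        using h(3)[of x] pos[of x "f x"] above[of x] by (auto simp: le_less)
      then show ?thesis
        using h(1)[of y] that True by simp
    next
      case False
      then show ?thesis
        using \<open>f x \<le> y\<close> h(1)[of y] h(2)[of x] by simp
    qed
  next
    case False
    show ?thesis
    proof (rule ccontr)
      assume "\<not> h x < h y"
      then have le: "y \<le> h y" "h y \<le> h x" "h x \<le> f x" "f x \<le> f y"
        using h[of x] h[of y] that monoD[OF mono(1), of x y] by auto
      \<comment> \<open>Additivity bounds \<open>\<Phi> x (h x)\<close> below by
        \<open>\<Phi> x y + \<Phi> y (h y)\<close>. By \<open>period\<close> the second summand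
        already equals \<open>\<Phi> x (h x)\<close>, while the first is positive.\<close>
      have "\<Phi> x (h x) = \<Phi> x y + \<Phi> y (h x)"
        using le that False by (intro add) auto
      moreover have "\<Phi> y (h x) = \<Phi> y (h y) + \<Phi> (h y) (h x)"
        using le monoD[OF mono(1), of y "h y"] h(2)[of y] by (intro add) auto
      moreover have "0 \<le> \<Phi> (h y) (h x)"
        using pos[of "h y" "h x"] refl[of "h x"] le monoD[OF mono(1), of y "h y"]
        by (cases "h y = h x") auto
      ultimately show False
        using pos[of x y] that False h(3)[of x] h(3)[of y] period[of x y] by simp
    qed
  qed
  moreover have "h (h x) = f x" for x
  proof (rule inj[of "h x"])
    \<comment> \<open>What remains from \<open>h x\<close> to \<open>f x\<close> is half of
      \<open>\<Phi> x (f x)\<close>, and by \<open>period\<close> this is also half of the total at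
      \<open>h x\<close>.\<close>
    show "\<Phi> (h x) (h (h x)) = \<Phi> (h x) (f x)"
      using add[of x "h x" "f x"] h[of x] h(3)[of "h x"] period[of x "h x"] monoD[OF mono(1) h(1)[of x]]
      by simp
  qed (use h monoD[OF mono(1)] in auto)
  ultimately show ?thesis
    by (intro exI[of _ h]) (auto simp: strict_mono_def)
qed

section \<open>Square roots of arbitrary increasing homeomorphisms\<close>

lemma strict_mono_sqrt_fixes:
  fixes h :: "'a::linorder \<Rightarrow> 'a"
  assumes "strict_mono h" "h (h x) = x"
  shows "h x = x"
  using strict_monoD[OF assms(1), of x "h x"] strict_monoD[OF assms(1), of "h x" x] assms(2)
  by (cases x "h x" rule: linorder_cases) auto

lemma strict_mono_surj_max_id:
  fixes f :: "real \<Rightarrow> real"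
  assumes f: "strict_mono f" "surj f"
  shows "strict_mono (\<lambda>x. max x (f x)) \<and> surj (\<lambda>x. max x (f x))"
proof
  show "strict_mono (\<lambda>x. max x (f x))"
  proof (rule strict_monoI)
    fix x y :: real assume "x < y"
    then show "max x (f x) < max y (f y)"
      using strict_monoD[OF f(1), of x y] by linarith
  qed
  \<comment> \<open>Either the \<open>f\<close>-preimage \<open>z\<close> of \<open>y\<close> works,
    or \<open>y < z\<close>, and then \<open>f y < y\<close> makes \<open>y\<close> its own
    preimage.\<close>
  have "\<exists>x. y = max x (f x)" for y
  proof -
    obtain z where z: "y = f z"
      using f(2) by (meson surjD)
    show ?thesis
    proof (cases "z \<le> y")
      case True
      then show ?thesis
        using z by (intro exI[of _ z]) (simp add: max_def)
    next
      case False
      then have "f y < y"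
        using strict_monoD[OF f(1), of y z] z by simp
      then show ?thesis
        by (intro exI[of _ y]) (simp add: max_def)
    qed
  qed
  then show "surj (\<lambda>x. max x (f x))"
    by (simp add: surj_def)
qed

text \<open>Where \<open>f\<close> lies above the identity only \<open>a\<close> moves points, where
  it lies below only \<open>b\<close> does; hence \<open>a \<circ> b\<close> is a root of
  \<open>f\<close>.\<close>

lemma strict_mono_sqrt:
  fixes f :: "real \<Rightarrow> real"
  assumes f: "strict_mono f" "surj f"
  shows "\<exists>h. strict_mono h \<and> h \<circ> h = f"
proof -
  obtain a where a: "strict_mono a" "a \<circ> a = (\<lambda>x. max x (f x))"
    using strict_mono_sqrt_above_id[of "\<lambda>x. max x (f x)"] strict_mono_surj_max_id[OF f] by auto
  \<comment> \<open>Conjugation by negation turns \<open>min x (f x)\<close> into a map above the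
    identity.\<close>
  define f' where "f' = (\<lambda>x. - f (- x))"
  have "strict_mono f'" "surj f'"
    using f surj_f_inv_f[OF f(2), of "- y" for y] unfolding f'_def strict_mono_def
    by (auto intro!: surjI[of _ "\<lambda>y. - inv f (- y)"])
  then obtain c where c: "strict_mono c" "c \<circ> c = (\<lambda>x. max x (f' x))"
    using strict_mono_sqrt_above_id[of "\<lambda>x. max x (f' x)"] strict_mono_surj_max_id[of f'] by auto
  define b where "b = (\<lambda>x. - c (- x))"
  have b: "strict_mono b"
    using c(1) unfolding b_def strict_mono_def by auto
  have aa: "a (a x) = max x (f x)" for x
    using a(2) by (metis comp_apply)
  have bb: "b (b x) = min x (f x)" for x
    using fun_cong[OF c(2), of "- x"] by (auto simp: b_def f'_def min_def max_def)
  have a_id: "a x = x" if "f x \<le> x" for x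
    using that aa[of x] by (intro strict_mono_sqrt_fixes[OF a(1)]) (simp add: max_def)
  have b_id: "b x = x" if "x \<le> f x" for x
    using that bb[of x] by (intro strict_mono_sqrt_fixes[OF b]) (simp add: min_def)
  have "a (b (a (b x))) = f x" for x
  proof (cases x "f x" rule: linorder_cases)
    case less
    \<comment> \<open>The point \<open>a x\<close> still satisfies \<open>a x < f (a x)\<close>, so
      \<open>b\<close> fixes it.\<close>
    then have "a x < max (a x) (f (a x))"
      using aa[of x] aa[of "a x"] strict_monoD[OF a(1), of x "a (a x)"] by simp
    then show ?thesis
      using less aa[of x] by (simp add: b_id)
  next
    case equal
    then show ?thesis
      by (simp add: a_id b_id)
  next
    case greater
    then have "min (b x) (f (b x)) < b x"
      using bb[of x] bb[of "b x"] strict_monoD[OF b, of "b (b x)" x] by simp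
    then show ?thesis
      using greater bb[of x] strict_monoD[OF f(1), of "f x" x] by (simp add: a_id)
  qed
  then show ?thesis
    using a(1) b by (intro exI[of _ "a \<circ> b"]) (auto simp: strict_mono_def)
qed

section \<open>Decreasing square roots and commuting involutions\<close>

lemma H_minus_sqrt_of_involution:
  assumes f: "f \<in> H_plus" and \<tau>: "\<tau> \<in> H_minus" "involution \<tau>" "\<tau> \<circ> f \<circ> \<tau> = f"
  shows "\<exists>g \<in> H_minus. g \<circ> g = f"
proof -
  have \<tau>\<tau>: "\<tau> (\<tau> x) = x" for x
    using \<tau>(2) by (metis involution_def comp_apply id_apply)
  have \<tau>f: "\<tau> (f (\<tau> x)) = f x" for x
    using \<tau>(3) by (metis comp_apply)
  obtain p where p: "\<tau> p = p"
    using H_minus_fixpoint[OF \<tau>(1)] .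
  then have "f p = p"
    using H_minus_fixpoint_unique[OF \<tau>(1)] \<tau>f[of p] by metis
  obtain h where h: "strict_mono h" "h \<circ> h = f"
    using strict_mono_sqrt f H_plus_iff by blast
  have hh: "h (h x) = f x" for x
    using h(2) by auto
  have hp: "h p = p"
    using strict_mono_sqrt_fixes[OF h(1)] hh \<open>f p = p\<close> by simp
  \<comment> \<open>\<open>h\<close> need not commute with \<open>\<tau>\<close>, hence the two
    orders of composition: from the right, \<open>g \<circ> g\<close> is
    \<open>h \<circ> \<tau> \<circ> \<tau> \<circ> h\<close>; from the left, it is
    \<open>\<tau> \<circ> h \<circ> h \<circ> \<tau>\<close>, which is \<open>f\<close> by
    hypothesis.\<close>
  define g where "g = (\<lambda>x. if p \<le> x then (\<tau> \<circ> h) x else (h \<circ> \<tau>) x)"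
  have right: "\<tau> (h x) \<le> p" if "p \<le> x" for x
    using H_minus_less_iff[OF \<tau>(1), of p "h x"] strict_mono_less[OF h(1), of x p] that p hp
    by (simp add: not_less[symmetric])
  have left: "p \<le> h (\<tau> x)" if "x < p" for x
    using H_minus_less_iff[OF \<tau>(1), of p x] strict_mono_less[OF h(1), of p "\<tau> x"] that p hp
    by simp
  have gg: "g (g x) = f x" for x
  proof (cases "p \<le> x")
    case True
    have "g (\<tau> (h x)) = h (\<tau> (\<tau> (h x)))"
      using right[OF True] p hp by (cases "\<tau> (h x) = p") (auto simp: g_def)
    then show ?thesis
      using True by (simp add: g_def \<tau>\<tau> hh)
  next
    case False
    then show ?thesis
      using left[of x] by (simp add: g_def hh \<tau>f)
  qed
  have "surj g"
    by (rule surjI[of _ "\<lambda>y. g (inv f y)"]) (use f gg in \<open>simp add: H_plus_iff surj_f_inv_f\<close>)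
  then have "g \<in> H_minus"
    unfolding g_def
    by (intro glue_H_minus)
      (use \<tau>(1) h(1) p hp in \<open>auto simp: H_minus_iff monotone_def strict_mono_def\<close>)
  then show ?thesis
    using gg by (intro bexI[of _ g]) auto
qed

text \<open>\<open>g\<close> and its inverse exchange the two sides of \<open>p\<close>, so applying
  \<open>\<tau>\<close> twice uses each once and they cancel. As \<open>g \<circ> g\<close>
  preserves the sides, the same cancellation occurs around it.\<close>

lemma involution_of_H_minus_sqrt:
  assumes g: "g \<in> H_minus"
  shows "\<exists>\<tau> \<in> H_minus. involution \<tau> \<and> \<tau> \<circ> (g \<circ> g) \<circ> \<tau> = g \<circ> g"
proof -
  obtain p where p: "g p = p"
    using H_minus_fixpoint[OF g] .
  define k where "k = inv g"
  have k: "k \<in> H_minus"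
    unfolding k_def using g by (rule inv_H_minus)
  have kg: "k (g x) = x" and gk: "g (k x) = x" for x
    using g H_minus_inject[OF g] by (auto simp: k_def H_minus_iff inj_def surj_f_inv_f)
  have kp: "k p = p"
    using kg[of p] p by simp
  define \<tau> where "\<tau> = (\<lambda>x. if p \<le> x then g x else k x)"
  have sides: "p \<le> g x \<longleftrightarrow> x \<le> p" "g x \<le> p \<longleftrightarrow> p \<le> x"
      "p \<le> k x \<longleftrightarrow> x \<le> p" "k x \<le> p \<longleftrightarrow> p \<le> x" for x
    using H_minus_less_iff[OF g, of x p] H_minus_less_iff[OF g, of p x]
      H_minus_less_iff[OF k, of x p] H_minus_less_iff[OF k, of p x] p kp
    by (auto simp: not_less[symmetric])
  have \<tau>\<tau>: "\<tau> (\<tau> x) = x" for x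
    using p kp by (cases x p rule: linorder_cases) (auto simp: \<tau>_def sides kg gk)
  then have "surj \<tau>"
    by (rule surjI)
  then have "\<tau> \<in> H_minus"
    unfolding \<tau>_def by (intro glue_H_minus) (use g k p kp in \<open>auto simp: H_minus_iff\<close>)
  moreover have "\<tau> (g (g (\<tau> x))) = g (g x)" for x
    using p kp by (cases x p rule: linorder_cases) (auto simp: \<tau>_def sides kg gk)
  ultimately show ?thesis
    using \<tau>\<tau> by (intro bexI[of _ \<tau>]) (auto simp: involution_def)
qed

theorem theorem1p3:
  fixes f :: "real \<Rightarrow> real"
  assumes "f \<in> H_plus"
  shows "(\<exists>\<tau> \<in> H_minus. involution \<tau> \<and> \<tau> \<circ> f \<circ> \<tau> = f) \<longleftrightarrow>
         (\<exists>g \<in> H_minus. g \<circ> g = f)"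
proof
  assume "\<exists>\<tau> \<in> H_minus. involution \<tau> \<and> \<tau> \<circ> f \<circ> \<tau> = f"
  then show "\<exists>g \<in> H_minus. g \<circ> g = f"
    using H_minus_sqrt_of_involution[OF assms] by blast
next
  assume "\<exists>g \<in> H_minus. g \<circ> g = f"
  then obtain g where "g \<in> H_minus" "f = g \<circ> g"
    by blast
  then show "\<exists>\<tau> \<in> H_minus. involution \<tau> \<and> \<tau> \<circ> f \<circ> \<tau> = f"
    using involution_of_H_minus_sqrt by simp
qed

end
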